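(* Let $(M,d)$ be a complete geodesic space such that $(M,d)$ and all its tangent spaces $(T^{(o)}_xM,d_x)$ (for every $x\in M$) are Busemann convex geodesic spaces. If the space $M\times_2\mathbb{R}$ satisfies any one of the properties (SO), (A) or (NE) below, then $(M,d)$ is a $CAT(0)$-space. For a complete geodesic space $(X,\delta)$ these properties are: (SO) for all geodesics $\gamma,\eta:[0,1]\to X$ with $\gamma_0=\eta_0$: $\gamma\perp_{\gamma_0}\eta$ iff $\eta\perp_{\gamma_0}\gamma$; (A) whenever $\gamma$ is a geodesic and $x\in X$, then for all $t\in[0,1]$ and $x_C\in\pi_\gamma(x)$: $\delta(x_C,\gamma_t)\le\delta(x,\gamma_t)$; (NE) whenever $C\subset X$ is closed and convex and $x,y\in X$, then for all $x_C\in\pi_C(x)$, $y_C\in\pi_C(y)$: $\delta(x_C,y_C)\le\delta(x,y)$.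
   Context: Geodesics are maps $\gamma:[0,1]\to X$ with $\delta(\gamma_t,\gamma_s)=|t-s|\delta(\gamma_0,\gamma_1)$. A geodesic space is Busemann convex if for all geodesics $\gamma,\eta$ with $\gamma_0=\eta_0$, $\delta(\gamma_{1/2},\eta_{1/2})\le\frac12\delta(\gamma_1,\eta_1)$. For geodesics with $p=\gamma_0=\eta_0$, $\gamma\perp_p\eta$ means $\delta(p,\gamma_t)\le\delta(\eta_s,\gamma_t)$ for all $s,t\in[0,1]$. $\pi_C(x)$ is the set of points of $C$ at minimal distance from $x$; $\pi_\gamma=\pi_{\gamma([0,1])}$. A set is convex if all geodesics between its points lie in it. $M\times_2\mathbb{R}$ is $M\times\mathbb{R}$ with metric $\tilde d((x,t),(y,s))^2=d(x,y)^2+|t-s|^2$. Tangent space: fix a sequence $\lambda_n>0$, $\lambda_n\to0$, and a non-principal ultrafilter $\omega$ on $\mathbb{N}$; $(T^{(o)}_xM,d_x)$ is the ultralimit of the pointed spaces $(M,\lambda_n^{-1}d,x)$, i.e. the set of sequences $(x_n)$ in $M$ with $\lim_\omega\lambda_n^{-1}d(x_n,x)<\infty$, modulo $\lim_\omega\lambda_n^{-1}d(x_n,y_n)=0$, with metric $d_x((x_n),(y_n))=\lim_\omega\lambda_n^{-1}d(x_n,y_n)$ (the hypothesis is for all such choices). $(M,d)$ is $CAT(0)$ if for all $x,y,z\in M$ and a Euclidean comparison triangle $\tilde x,\tilde y,\tilde z\in\mathbb{R}^2$ with the same side lengths, $d(x,m)\le\|\tilde x-\tilde m\|$, where $m,\tilde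 m$ are midpoints of $y,z$ resp. $\tilde y,\tilde z$. *)

theory Defs
  imports "HOL-Analysis.Analysis"
begin

definition geodesic :: "'a set \<Rightarrow> ('a \<Rightarrow> 'a \<Rightarrow> real) \<Rightarrow> (real \<Rightarrow> 'a) \<Rightarrow> bool" where
  "geodesic X \<delta> \<gamma> \<longleftrightarrow> (\<forall>t\<in>{0..1}. \<gamma> t \<in> X) \<and>
     (\<forall>s\<in>{0..1}. \<forall>t\<in>{0..1}. \<delta> (\<gamma> t) (\<gamma> s) = \<bar>t - s\<bar> * \<delta> (\<gamma> 0) (\<gamma> 1))"

definition geodesic_space :: "'a set \<Rightarrow> ('a \<Rightarrow> 'a \<Rightarrow> real) \<Rightarrow> bool" where
  "geodesic_space X \<delta> \<longleftrightarrow> (\<forall>x\<in>X. \<forall>y\<in>X. \<exists>\<gamma>. geodesic X \<delta> \<gamma> \<and> \<gamma> 0 = x \<and> \<gamma> 1 = y)"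

definition busemann_convex :: "'a set \<Rightarrow> ('a \<Rightarrow> 'a \<Rightarrow> real) \<Rightarrow> bool" where
  "busemann_convex X \<delta> \<longleftrightarrow> (\<forall>\<gamma> \<eta>. geodesic X \<delta> \<gamma> \<and> geodesic X \<delta> \<eta> \<and> \<gamma> 0 = \<eta> 0 \<longrightarrow>
     \<delta> (\<gamma> (1/2)) (\<eta> (1/2)) \<le> \<delta> (\<gamma> 1) (\<eta> 1) / 2)"

definition perp :: "('a \<Rightarrow> 'a \<Rightarrow> real) \<Rightarrow> 'a \<Rightarrow> (real \<Rightarrow> 'a) \<Rightarrow> (real \<Rightarrow> 'a) \<Rightarrow> bool" where
  "perp \<delta> p \<gamma> \<eta> \<longleftrightarrow> (\<forall>s\<in>{0..1}. \<forall>t\<in>{0..1}. \<delta> p (\<gamma> t) \<le> \<delta> (\<eta> s) (\<gamma> t))"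

definition proj :: "('a \<Rightarrow> 'a \<Rightarrow> real) \<Rightarrow> 'a set \<Rightarrow> 'a \<Rightarrow> 'a set" where
  "proj \<delta> C x = {c \<in> C. \<forall>c'\<in>C. \<delta> x c \<le> \<delta> x c'}"

definition geod_convex :: "'a set \<Rightarrow> ('a \<Rightarrow> 'a \<Rightarrow> real) \<Rightarrow> 'a set \<Rightarrow> bool" where
  "geod_convex X \<delta> C \<longleftrightarrow> C \<subseteq> X \<and>
     (\<forall>\<gamma>. geodesic X \<delta> \<gamma> \<and> \<gamma> 0 \<in> C \<and> \<gamma> 1 \<in> C \<longrightarrow> \<gamma> ` {0..1} \<subseteq> C)"

definition prop_SO :: "'a set \<Rightarrow> ('a \<Rightarrow> 'a \<Rightarrow> real) \<Rightarrow> bool" where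
  "prop_SO X \<delta> \<longleftrightarrow> (\<forall>\<gamma> \<eta>. geodesic X \<delta> \<gamma> \<and> geodesic X \<delta> \<eta> \<and> \<gamma> 0 = \<eta> 0 \<longrightarrow>
     (perp \<delta> (\<gamma> 0) \<gamma> \<eta> \<longleftrightarrow> perp \<delta> (\<gamma> 0) \<eta> \<gamma>))"

definition prop_A :: "'a set \<Rightarrow> ('a \<Rightarrow> 'a \<Rightarrow> real) \<Rightarrow> bool" where
  "prop_A X \<delta> \<longleftrightarrow> (\<forall>\<gamma> x. geodesic X \<delta> \<gamma> \<and> x \<in> X \<longrightarrow>
     (\<forall>t\<in>{0..1}. \<forall>xc\<in>proj \<delta> (\<gamma> ` {0..1}) x. \<delta> xc (\<gamma> t) \<le> \<delta> x (\<gamma> t)))"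

definition prop_NE :: "'a set \<Rightarrow> ('a \<Rightarrow> 'a \<Rightarrow> real) \<Rightarrow> bool" where
  "prop_NE X \<delta> \<longleftrightarrow> (\<forall>C x y. C \<subseteq> X \<and> closedin (Metric_space.mtopology X \<delta>) C \<and>
     geod_convex X \<delta> C \<and> x \<in> X \<and> y \<in> X \<longrightarrow>
     (\<forall>xc\<in>proj \<delta> C x. \<forall>yc\<in>proj \<delta> C y. \<delta> xc yc \<le> \<delta> x y))"

definition prod2_carrier :: "'a set \<Rightarrow> ('a \<times> real) set" where
  "prod2_carrier M = M \<times> UNIV"

definition prod2_dist :: "('a \<Rightarrow> 'a \<Rightarrow> real) \<Rightarrow> ('a \<times> real) \<Rightarrow> ('a \<times> real) \<Rightarrow> real" where
  "prod2_dist d p q = sqrt ((d (fst p) (fst q))\<^sup>2 + (snd p - snd q)\<^sup>2)"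

text \<open>Ultrafilters and tangent spaces (ultralimits of rescaled pointed spaces).\<close>
definition nonprincipal_ultrafilter :: "nat filter \<Rightarrow> bool" where
  "nonprincipal_ultrafilter \<omega> \<longleftrightarrow> \<omega> \<noteq> bot \<and>
     (\<forall>P. eventually P \<omega> \<or> eventually (\<lambda>n. \<not> P n) \<omega>) \<and>
     (\<forall>n. eventually (\<lambda>k. k \<noteq> n) \<omega>)"

definition tan_seqs :: "'a set \<Rightarrow> ('a \<Rightarrow> 'a \<Rightarrow> real) \<Rightarrow> (nat \<Rightarrow> real) \<Rightarrow> nat filter \<Rightarrow> 'a \<Rightarrow> (nat \<Rightarrow> 'a) set" where
  "tan_seqs M d lam \<omega> x = {s. (\<forall>n. s n \<in> M) \<and> (\<exists>C. eventually (\<lambda>n. d (s n) x / lam n \<le> C) \<omega>)}"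

definition tan_rel :: "('a \<Rightarrow> 'a \<Rightarrow> real) \<Rightarrow> (nat \<Rightarrow> real) \<Rightarrow> nat filter \<Rightarrow> (nat \<Rightarrow> 'a) \<Rightarrow> (nat \<Rightarrow> 'a) \<Rightarrow> bool" where
  "tan_rel d lam \<omega> s t \<longleftrightarrow> ((\<lambda>n. d (s n) (t n) / lam n) \<longlongrightarrow> 0) \<omega>"

definition tan_space :: "'a set \<Rightarrow> ('a \<Rightarrow> 'a \<Rightarrow> real) \<Rightarrow> (nat \<Rightarrow> real) \<Rightarrow> nat filter \<Rightarrow> 'a \<Rightarrow> (nat \<Rightarrow> 'a) set set" where
  "tan_space M d lam \<omega> x =
     (\<lambda>s. {t \<in> tan_seqs M d lam \<omega> x. tan_rel d lam \<omega> s t}) ` tan_seqs M d lam \<omega> x"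

definition tan_dist :: "('a \<Rightarrow> 'a \<Rightarrow> real) \<Rightarrow> (nat \<Rightarrow> real) \<Rightarrow> nat filter \<Rightarrow> (nat \<Rightarrow> 'a) set \<Rightarrow> (nat \<Rightarrow> 'a) set \<Rightarrow> real" where
  "tan_dist d lam \<omega> A B = Lim \<omega> (\<lambda>n. d ((SOME s. s \<in> A) n) ((SOME t. t \<in> B) n) / lam n)"

definition CAT0 :: "'a set \<Rightarrow> ('a \<Rightarrow> 'a \<Rightarrow> real) \<Rightarrow> bool" where
  "CAT0 M d \<longleftrightarrow> (\<forall>x\<in>M. \<forall>y\<in>M. \<forall>z\<in>M. \<forall>\<gamma>. geodesic M d \<gamma> \<and> \<gamma> 0 = y \<and> \<gamma> 1 = z \<longrightarrow>
     (\<forall>x' y' z' :: real^2. dist x' y' = d x y \<and> dist x' z' = d x z \<and> dist y' z' = d y z \<longrightarrow>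
        d x (\<gamma> (1/2)) \<le> dist x' (midpoint y' z')))"

end

theory Submission
  imports Defs "HOL-Real_Asymp.Real_Asymp"
begin

text \<open>
  Under (SO) the two first variations along geodesics \<open>\<alpha>\<close>, \<open>\<beta>\<close> with
  \<open>\<alpha> 0 = \<beta> 0\<close>, namely that of \<open>d (\<beta> 1)\<^sup>2 / 2\<close> along \<open>\<alpha>\<close> and that of \<open>d (\<alpha> 1)\<^sup>2 / 2\<close> along \<open>\<beta>\<close>,
  agree: tilting both geodesics in the \<open>\<real>\<close> direction turns a lower bound on either of them into an
  orthogonality relation in \<open>M \<times>\<^sub>2 \<real>\<close>. Let \<open>\<gamma>\<close> have speed \<open>L\<close> and let \<open>y\<close> be a point. The derivative of
  \<open>K t = d y (\<gamma> t)\<^sup>2\<close> at \<open>t\<close>, exchanged for a first variation along the geodesic from \<open>\<gamma> t\<close> to \<open>y\<close>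
  of the distance to \<open>\<gamma> 0\<close>, is at least \<open>2 L (t L - d y (\<gamma> 0))\<close> by convexity. Integrating this
  for a point \<open>y\<close> on the geodesic from \<open>\<gamma> a\<close> to \<open>x\<close> close to \<open>\<gamma> a\<close>, and rescaling by Busemann
  convexity, shows that \<open>d x (\<gamma> t)\<^sup>2\<close> lies above the parabola with leading coefficient \<open>L\<^sup>2\<close> whose
  initial slope at \<open>a\<close> is the slope of any secant to the left of \<open>a\<close>. Comparing from both sides gives
  the midpoint inequality.

  (A) implies (SO) directly, and (NE) implies (A) because geodesics in \<open>M \<times>\<^sub>2 \<real>\<close> are unique, so that
  their images are closed convex sets.
\<close>

section \<open>Elementary inequalities and the Euclidean median formula\<close>

lemma real_le_of_forall_eps:
  fixes x y C :: real
  assumes "\<And>e. 0 < e \<Longrightarrow> e \<le> 1 \<Longrightarrow> x \<le> y + e * C"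
  shows "x \<le> y"
proof (rule tendsto_lowerbound)
  show "((\<lambda>e. y + e * C) \<longlongrightarrow> y) (at_right 0)"
    by real_asymp
  show "\<forall>\<^sub>F e in at_right 0. x \<le> y + e * C"
    using eventually_at_right_real[of 0 "1::real"] by (rule eventually_mono) (auto intro: assms)
qed simp

lemma real_le_of_forall_halving:
  fixes x y C :: real
  assumes "\<And>n::nat. x \<le> y + C / 2 ^ n"
  shows "x \<le> y"
proof (rule LIMSEQ_le_const)
  show "(\<lambda>n::nat. y + C / 2 ^ n) \<longlonglongrightarrow> y"
    by real_asymp
qed (use assms in auto)

text \<open>Each bisection of \<open>[a, b]\<close> halves the sum of the squared lengths of the
  pieces, so the total defect tends to 0. This replaces the integration of a derivative that need
  not exist.\<close>

lemma mono_of_quadratic_defect: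
  fixes R :: "real \<Rightarrow> real"
  assumes step: "\<And>a b. 0 < a \<Longrightarrow> a \<le> b \<Longrightarrow> b \<le> 1 \<Longrightarrow> R a \<le> R b + C * (b - a)\<^sup>2"
    and "0 < a" "a \<le> b" "b \<le> 1"
  shows "R a \<le> R b"
proof -
  have "R a \<le> R b + C * (b - a)\<^sup>2 / 2 ^ n" for n
    using assms(2-4)
  proof (induction n arbitrary: a b)
    case 0
    then show ?case using step by simp
  next
    case (Suc n)
    let ?m = "(a + b) / 2"
    have half: "?m - a = (b - a) / 2" "b - ?m = (b - a) / 2"
      by (simp_all add: field_simps)
    have "R a \<le> R ?m + C * (?m - a)\<^sup>2 / 2 ^ n" "R ?m \<le> R b + C * (b - ?m)\<^sup>2 / 2 ^ n"
      using Suc.prems by (intro Suc.IH; simp)+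
    then show ?case unfolding half by (simp add: power_divide)
  qed
  then show ?thesis by (rule real_le_of_forall_halving)
qed

lemma comparison_midpoint:
  fixes x y z :: "'a::real_inner"
  shows "(dist x (midpoint y z))\<^sup>2 = (dist x y)\<^sup>2 / 2 + (dist x z)\<^sup>2 / 2 - (dist y z)\<^sup>2 / 4"
  unfolding dist_norm power2_norm_eq_inner midpoint_def
  by (simp add: inner_diff_left inner_diff_right inner_add_left inner_add_right
      inner_commute field_simps)

section \<open>Geodesics in general spaces\<close>

lemma geodesic_in: "geodesic X \<delta> \<gamma> \<Longrightarrow> 0 \<le> t \<Longrightarrow> t \<le> 1 \<Longrightarrow> \<gamma> t \<in> X"
  unfolding geodesic_def by (meson atLeastAtMost_iff)

lemma geodesic_dist:
  "geodesic X \<delta> \<gamma> \<Longrightarrow> 0 \<le> t \<Longrightarrow> t \<le> 1 \<Longrightarrow> 0 \<le> s \<Longrightarrow> s \<le> 1 \<Longrightarrow>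
   \<delta> (\<gamma> t) (\<gamma> s) = \<bar>t - s\<bar> * \<delta> (\<gamma> 0) (\<gamma> 1)"
  unfolding geodesic_def by (meson atLeastAtMost_iff)

lemma affine_in_unit_interval:
  fixes a b t :: real
  assumes "0 \<le> a" "a \<le> 1" "0 \<le> b" "b \<le> 1" "0 \<le> t" "t \<le> 1"
  shows "0 \<le> a + t * (b - a)" "a + t * (b - a) \<le> 1"
proof -
  have "a + t * (b - a) = (1 - t) * a + t * b" by (simp add: algebra_simps)
  moreover have "(1 - t) * a + t * b \<le> 1"
    using assms by (intro convex_bound_le) auto
  ultimately show "0 \<le> a + t * (b - a)" "a + t * (b - a) \<le> 1"
    using assms by auto
qed

text \<open>No order between \<open>a\<close> and \<open>b\<close> is required, so reversed
  geodesics are covered.\<close>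

lemma geodesic_sub:
  assumes "geodesic X \<delta> \<gamma>" "0 \<le> a" "a \<le> 1" "0 \<le> b" "b \<le> 1"
  shows "geodesic X \<delta> (\<lambda>t. \<gamma> (a + t * (b - a)))"
  unfolding geodesic_def
proof (intro conjI ballI)
  fix t :: real assume t: "t \<in> {0..1}"
  then show "\<gamma> (a + t * (b - a)) \<in> X"
    using affine_in_unit_interval[OF assms(2-)] by (intro geodesic_in[OF assms(1)]) auto
next
  fix s t :: real assume "s \<in> {0..1}" "t \<in> {0..1}"
  then have "\<delta> (\<gamma> (a + t * (b - a))) (\<gamma> (a + s * (b - a)))
      = \<bar>(a + t * (b - a)) - (a + s * (b - a))\<bar> * \<delta> (\<gamma> 0) (\<gamma> 1)"
    using affine_in_unit_interval[OF assms(2-)] by (intro geodesic_dist[OF assms(1)]) auto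
  also have "(a + t * (b - a)) - (a + s * (b - a)) = (t - s) * (b - a)"
    by (simp add: algebra_simps)
  also have "\<bar>(t - s) * (b - a)\<bar> * \<delta> (\<gamma> 0) (\<gamma> 1) = \<bar>t - s\<bar> * (\<bar>a - b\<bar> * \<delta> (\<gamma> 0) (\<gamma> 1))"
    by (simp add: abs_mult abs_minus_commute)
  also have "\<bar>a - b\<bar> * \<delta> (\<gamma> 0) (\<gamma> 1) = \<delta> (\<gamma> a) (\<gamma> b)"
    using assms geodesic_dist[OF assms(1), of a b] by simp
  finally show "\<delta> (\<gamma> (a + t * (b - a))) (\<gamma> (a + s * (b - a)))
      = \<bar>t - s\<bar> * \<delta> (\<gamma> (a + 0 * (b - a))) (\<gamma> (a + 1 * (b - a)))"
    by simp
qed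

text \<open>\<open>perp\<close> says that the common starting point is a nearest point of
  \<open>\<eta>\<close> to every \<open>\<gamma> s\<close>; (A) for that projection is the reversed
  relation.\<close>

lemma SO_of_A:
  assumes com: "\<And>x y. \<delta> x y = \<delta> y x" and A: "prop_A X \<delta>"
  shows "prop_SO X \<delta>"
proof -
  have "perp \<delta> (\<gamma> 0) \<eta> \<gamma>"
    if \<gamma>: "geodesic X \<delta> \<gamma>" and \<eta>: "geodesic X \<delta> \<eta>" and eq: "\<gamma> 0 = \<eta> 0"
      and p: "perp \<delta> (\<gamma> 0) \<gamma> \<eta>" for \<gamma> \<eta>
    unfolding perp_def
  proof (intro ballI)
    fix s t :: real assume st: "s \<in> {0..1}" "t \<in> {0..1}"
    have "\<gamma> 0 \<in> proj \<delta> (\<eta> ` {0..1}) (\<gamma> s)"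
      using p st unfolding proj_def perp_def by (auto simp: eq com)
    moreover have "\<gamma> s \<in> X" using \<gamma> st by (auto intro: geodesic_in)
    ultimately show "\<delta> (\<gamma> 0) (\<eta> t) \<le> \<delta> (\<gamma> s) (\<eta> t)"
      using A \<eta> st unfolding prop_A_def by blast
  qed
  then show ?thesis
    unfolding prop_SO_def by metis
qed

text \<open>The distance from an outside point is continuous along \<open>\<gamma>\<close>, hence
  attains a positive minimum on \<open>{0..1}\<close>; the minimum is the radius of a ball that
  misses the image.\<close>

lemma (in Metric_space) closedin_geodesic_image:
  assumes \<gamma>: "geodesic M d \<gamma>"
  shows "closedin mtopology (\<gamma> ` {0..1})"
  unfolding closedin_metric
proof (intro conjI allI impI)
  show "\<gamma> ` {0..1} \<subseteq> M" using \<gamma> by (auto intro: geodesic_in)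
  fix x assume x: "x \<in> M - \<gamma> ` {0..1}"
  have "\<bar>d x (\<gamma> t) - d x (\<gamma> s)\<bar> \<le> d (\<gamma> 0) (\<gamma> 1) * \<bar>t - s\<bar>"
    if "s \<in> {0..1}" "t \<in> {0..1}" for s t
  proof -
    have inM: "\<gamma> s \<in> M" "\<gamma> t \<in> M" "x \<in> M" using that \<gamma> x by (auto intro: geodesic_in)
    have "\<bar>d x (\<gamma> t) - d x (\<gamma> s)\<bar> \<le> d (\<gamma> t) (\<gamma> s)"
      using triangle[OF inM(3,1,2)] triangle[OF inM(3,2,1)]
      by (simp add: commute abs_le_iff)
    then show ?thesis using geodesic_dist[OF \<gamma>, of t s] that by (simp add: mult.commute)
  qed
  then have "(d (\<gamma> 0) (\<gamma> 1))-lipschitz_on {0..1} (\<lambda>t. d x (\<gamma> t))"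
    by (intro lipschitz_onI) (auto simp: dist_real_def)
  then have "continuous_on {0..1} (\<lambda>t. d x (\<gamma> t))"
    by (rule lipschitz_on_continuous_on)
  then obtain m where m: "m \<in> {0..1}" "\<And>t. t \<in> {0..1} \<Longrightarrow> d x (\<gamma> m) \<le> d x (\<gamma> t)"
    using continuous_attains_inf[of "{0..1::real}" "\<lambda>t. d x (\<gamma> t)"] by auto
  have "disjnt (\<gamma> ` {0..1}) (mball x (d x (\<gamma> m)))"
    using m by (fastforce simp: disjnt_iff)
  moreover have "0 < d x (\<gamma> m)"
    using x m(1) \<gamma> by (intro mdist_pos_less) (auto intro: geodesic_in)
  ultimately show "\<exists>r>0. disjnt (\<gamma> ` {0..1}) (mball x r)" by blast
qed

text \<open>The equality case of the triangle inequality in the plane: by Cauchy-Schwarz the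
  products of \<open>(e1, f1)\<close> and \<open>(e2, f2)\<close> with \<open>(D, F)\<close> are as
  large as they can be, which forces \<open>(e1, f1)\<close> to be parallel to
  \<open>(D, F)\<close>.\<close>

lemma minkowski_equality:
  fixes e1 e2 f1 f2 D F t :: real
  assumes nn: "0 \<le> D" "0 \<le> F"
    and ge: "D \<le> e1 + e2" "F \<le> f1 + f2"
    and eq: "e1\<^sup>2 + f1\<^sup>2 = t\<^sup>2 * (D\<^sup>2 + F\<^sup>2)" "e2\<^sup>2 + f2\<^sup>2 = (1 - t)\<^sup>2 * (D\<^sup>2 + F\<^sup>2)"
    and t: "0 \<le> t" "t \<le> 1"
  shows "e1 = t * D" "f1 = t * F"
proof -
  have cs: "u * D + v * F \<le> r * (D\<^sup>2 + F\<^sup>2)"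
    if "u\<^sup>2 + v\<^sup>2 = r\<^sup>2 * (D\<^sup>2 + F\<^sup>2)" "0 \<le> r" for u v r
  proof (rule power2_le_imp_le)
    have "(u * D + v * F)\<^sup>2 \<le> (u\<^sup>2 + v\<^sup>2) * (D\<^sup>2 + F\<^sup>2)"
      using zero_le_power2[of "u * F - v * D"] by (simp add: power2_eq_square algebra_simps)
    then show "(u * D + v * F)\<^sup>2 \<le> (r * (D\<^sup>2 + F\<^sup>2))\<^sup>2"
      unfolding that(1) by (simp add: power2_eq_square mult_ac)
  qed (use that in auto)
  have "D * D + F * F \<le> (e1 + e2) * D + (f1 + f2) * F"
    using nn ge by (intro add_mono mult_right_mono) auto
  with cs[OF eq(1) t(1)] cs[OF eq(2)] t
  have "e1 * D + f1 * F = t * (D\<^sup>2 + F\<^sup>2)"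
    by (simp add: power2_eq_square algebra_simps)
  moreover have "(e1 - t * D)\<^sup>2 + (f1 - t * F)\<^sup>2
      = (e1\<^sup>2 + f1\<^sup>2) - 2 * t * (e1 * D + f1 * F) + t\<^sup>2 * (D\<^sup>2 + F\<^sup>2)"
    by (simp add: power2_eq_square algebra_simps)
  ultimately have "(e1 - t * D)\<^sup>2 + (f1 - t * F)\<^sup>2 = (e1\<^sup>2 + f1\<^sup>2) - t\<^sup>2 * (D\<^sup>2 + F\<^sup>2)"
    by (simp add: power2_eq_square)
  then show "e1 = t * D" "f1 = t * F"
    unfolding eq by (simp_all)
qed

section \<open>Convexity of the distance in Busemann spaces\<close>

locale busemann_space = Metric_space M d for M :: "'a set" and d :: "'a \<Rightarrow> 'a \<Rightarrow> real" +
  assumes geodesic_space: "geodesic_space M d"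
    and busemann: "busemann_convex M d"
begin

lemma obtain_geodesic:
  assumes "x \<in> M" "y \<in> M"
  obtains \<gamma> where "geodesic M d \<gamma>" "\<gamma> 0 = x" "\<gamma> 1 = y"
  using geodesic_space assms unfolding geodesic_space_def by blast

lemma busemann_mid:
  "geodesic M d \<gamma> \<Longrightarrow> geodesic M d \<eta> \<Longrightarrow> \<gamma> 0 = \<eta> 0 \<Longrightarrow>
   d (\<gamma> (1/2)) (\<eta> (1/2)) \<le> d (\<gamma> 1) (\<eta> 1) / 2"
  using busemann unfolding busemann_convex_def by blast

text \<open>The diagonal \<open>\<kappa>\<close> from \<open>\<gamma> 0\<close> to
  \<open>\<eta> 1\<close> splits the quadrilateral into two triangles, with apexes
  \<open>\<gamma> 0\<close> and \<open>\<eta> 1\<close>.\<close>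

lemma midpoint_convex_dist:
  assumes \<gamma>: "geodesic M d \<gamma>" and \<eta>: "geodesic M d \<eta>"
  shows "d (\<gamma> (1/2)) (\<eta> (1/2)) \<le> (d (\<gamma> 0) (\<eta> 0) + d (\<gamma> 1) (\<eta> 1)) / 2"
proof -
  have inM: "\<gamma> 0 \<in> M" "\<eta> 1 \<in> M" "\<gamma> (1/2) \<in> M" "\<eta> (1/2) \<in> M"
    using \<gamma> \<eta> by (auto intro: geodesic_in)
  obtain \<kappa> where \<kappa>: "geodesic M d \<kappa>" "\<kappa> 0 = \<gamma> 0" "\<kappa> 1 = \<eta> 1"
    using obtain_geodesic inM by blast
  have "d (\<gamma> (1/2)) (\<kappa> (1/2)) \<le> d (\<gamma> 1) (\<eta> 1) / 2"
    using busemann_mid[OF \<gamma> \<kappa>(1)] \<kappa> by simp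
  moreover have "d (\<kappa> (1/2)) (\<eta> (1/2)) \<le> d (\<gamma> 0) (\<eta> 0) / 2"
    using busemann_mid[OF geodesic_sub[OF \<kappa>(1), of 1 0] geodesic_sub[OF \<eta>, of 1 0]] \<kappa>
    by simp
  moreover have "d (\<gamma> (1/2)) (\<eta> (1/2)) \<le> d (\<gamma> (1/2)) (\<kappa> (1/2)) + d (\<kappa> (1/2)) (\<eta> (1/2))"
    using \<kappa> inM by (intro triangle) (auto intro: geodesic_in)
  ultimately show ?thesis by argo
qed

text \<open>\<open>t\<close> is the midpoint of \<open>0\<close> and \<open>2*t\<close>, or of
  \<open>2*t-1\<close> and \<open>1\<close>; either way the midpoint inequality halves the error of
  a crude bound, so neither dyadic parameters nor continuity enter.\<close>

lemma dist_geodesics_le: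
  assumes \<gamma>: "geodesic M d \<gamma>" and \<eta>: "geodesic M d \<eta>" and eq: "\<gamma> 0 = \<eta> 0"
    and "0 \<le> t" "t \<le> 1"
  shows "d (\<gamma> t) (\<eta> t) \<le> t * d (\<gamma> 1) (\<eta> 1)"
proof -
  define C where "C = d (\<gamma> 0) (\<gamma> 1) + d (\<eta> 0) (\<eta> 1)"
  have "d (\<gamma> t) (\<eta> t) \<le> t * d (\<gamma> 1) (\<eta> 1) + C / 2 ^ n" for n
    using assms(4,5)
  proof (induction n arbitrary: t)
    case 0
    have "d (\<gamma> t) (\<eta> t) \<le> d (\<gamma> t) (\<gamma> 0) + d (\<gamma> 0) (\<eta> t)"
      using \<gamma> \<eta> 0 by (intro triangle) (auto intro: geodesic_in)
    also have "d (\<gamma> t) (\<gamma> 0) = t * d (\<gamma> 0) (\<gamma> 1)"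
      using 0 geodesic_dist[OF \<gamma>, of t 0] by simp
    also have "d (\<gamma> 0) (\<eta> t) = t * d (\<eta> 0) (\<eta> 1)"
      using 0 geodesic_dist[OF \<eta>, of 0 t] eq by simp
    also have "t * d (\<gamma> 0) (\<gamma> 1) + t * d (\<eta> 0) (\<eta> 1) \<le> 1 * C"
      unfolding C_def using 0 by (simp only: distrib_left[symmetric]) (intro mult_right_mono, auto)
    finally show ?case using 0 by (simp add: add_increasing)
  next
    case (Suc n)
    show ?case
    proof (cases "t \<le> 1/2")
      case True
      have "d (\<gamma> t) (\<eta> t) \<le> d (\<gamma> (2*t)) (\<eta> (2*t)) / 2"
        using busemann_mid[OF geodesic_sub[OF \<gamma>, of 0 "2*t"] geodesic_sub[OF \<eta>, of 0 "2*t"]]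
          True Suc.prems eq by simp
      also have "d (\<gamma> (2*t)) (\<eta> (2*t)) \<le> (2*t) * d (\<gamma> 1) (\<eta> 1) + C / 2 ^ n"
        using True Suc.prems by (intro Suc.IH) auto
      finally show ?thesis by simp
    next
      case False
      have mid: "2 * t - 1 + 1 / 2 * (1 - (2 * t - 1)) = t" by (simp add: field_simps)
      have "d (\<gamma> t) (\<eta> t) \<le> (d (\<gamma> (2*t-1)) (\<eta> (2*t-1)) + d (\<gamma> 1) (\<eta> 1)) / 2"
        using midpoint_convex_dist[OF geodesic_sub[OF \<gamma>, of "2*t-1" 1] geodesic_sub[OF \<eta>, of "2*t-1" 1]]
          False Suc.prems unfolding mid by simp
      moreover have "d (\<gamma> (2*t-1)) (\<eta> (2*t-1)) \<le> (2*t-1) * d (\<gamma> 1) (\<eta> 1) + C / 2 ^ n"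
        using False Suc.prems by (intro Suc.IH) auto
      ultimately have "d (\<gamma> t) (\<eta> t)
          \<le> (((2*t-1) * d (\<gamma> 1) (\<eta> 1) + C / 2 ^ n) + d (\<gamma> 1) (\<eta> 1)) / 2"
        by (meson add_right_mono divide_right_mono order_trans zero_le_numeral)
      also have "\<dots> = t * d (\<gamma> 1) (\<eta> 1) + C / 2 ^ Suc n"
        by (simp add: field_simps)
      finally show ?thesis .
    qed
  qed
  then show ?thesis by (rule real_le_of_forall_halving)
qed

lemma geodesic_unique:
  assumes "geodesic M d \<gamma>" "geodesic M d \<eta>" "\<gamma> 0 = \<eta> 0" "\<gamma> 1 = \<eta> 1" "0 \<le> t" "t \<le> 1"
  shows "\<gamma> t = \<eta> t"
proof -
  have "\<gamma> t \<in> M" "\<eta> t \<in> M" "\<eta> 1 \<in> M" using assms by (auto intro: geodesic_in)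
  then show ?thesis
    using dist_geodesics_le[OF assms(1-3,5,6)] assms(4) nonneg[of "\<gamma> t" "\<eta> t"] by simp
qed

lemma dist_point_convex:
  assumes x: "x \<in> M" and \<gamma>: "geodesic M d \<gamma>" and t: "0 \<le> t" "t \<le> 1"
  shows "d x (\<gamma> t) \<le> (1 - t) * d x (\<gamma> 0) + t * d x (\<gamma> 1)"
proof -
  have inM: "\<gamma> 0 \<in> M" "\<gamma> t \<in> M" using \<gamma> t by (auto intro: geodesic_in)
  obtain \<kappa> where \<kappa>: "geodesic M d \<kappa>" "\<kappa> 0 = \<gamma> 0" "\<kappa> 1 = x"
    using obtain_geodesic inM x by blast
  have "d x (\<gamma> t) \<le> d x (\<kappa> t) + d (\<kappa> t) (\<gamma> t)"
    using \<kappa> inM x t by (intro triangle) (auto intro: geodesic_in)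
  moreover have "d x (\<kappa> t) = (1 - t) * d x (\<gamma> 0)"
    using geodesic_dist[OF \<kappa>(1), of 1 t] \<kappa> t by (simp add: commute)
  moreover have "d (\<kappa> t) (\<gamma> t) \<le> t * d x (\<gamma> 1)"
    using dist_geodesics_le[OF \<kappa>(1) \<gamma> _ t] \<kappa> by simp
  ultimately show ?thesis by simp
qed

lemma dist_square_convex:
  assumes x: "x \<in> M" and \<gamma>: "geodesic M d \<gamma>" and t: "0 \<le> t" "t \<le> 1"
  shows "(d x (\<gamma> t))\<^sup>2 \<le> (1 - t) * (d x (\<gamma> 0))\<^sup>2 + t * (d x (\<gamma> 1))\<^sup>2"
proof -
  let ?a = "d x (\<gamma> 0)" and ?b = "d x (\<gamma> 1)"
  have "(d x (\<gamma> t))\<^sup>2 \<le> ((1 - t) * ?a + t * ?b)\<^sup>2"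
    using dist_point_convex[OF assms] by (intro power_mono) auto
  also have "\<dots> = (1 - t) * ?a\<^sup>2 + t * ?b\<^sup>2 - t * (1 - t) * (?a - ?b)\<^sup>2"
    by (simp add: power2_eq_square algebra_simps)
  also have "\<dots> \<le> (1 - t) * ?a\<^sup>2 + t * ?b\<^sup>2" using t by simp
  finally show ?thesis .
qed

lemma dist_square_three_point:
  assumes x: "x \<in> M" and \<gamma>: "geodesic M d \<gamma>" and r: "0 \<le> r" "r \<le> a" "a \<le> b" "b \<le> 1"
  shows "(b - r) * (d x (\<gamma> a))\<^sup>2 \<le> (b - a) * (d x (\<gamma> r))\<^sup>2 + (a - r) * (d x (\<gamma> b))\<^sup>2"
proof (cases "r = b")
  case False
  define t where "t = (a - r) / (b - r)"
  have t: "0 \<le> t" "t \<le> 1" and at: "r + t * (b - r) = a" and bt: "(b - r) * t = a - r"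
    using False r by (auto simp: t_def)
  have "(d x (\<gamma> a))\<^sup>2 \<le> (1 - t) * (d x (\<gamma> r))\<^sup>2 + t * (d x (\<gamma> b))\<^sup>2"
    using dist_square_convex[OF x geodesic_sub[OF \<gamma>, of r b] t] at r by simp
  then have "(b - r) * (d x (\<gamma> a))\<^sup>2
      \<le> (b - r) * ((1 - t) * (d x (\<gamma> r))\<^sup>2 + t * (d x (\<gamma> b))\<^sup>2)"
    using r by (intro mult_left_mono) auto
  also have "\<dots> = ((b - r) - (b - r) * t) * (d x (\<gamma> r))\<^sup>2 + ((b - r) * t) * (d x (\<gamma> b))\<^sup>2"
    by (simp add: algebra_simps)
  finally show ?thesis unfolding bt by simp
qed (use r in auto)

text \<open>The hypothesis says that the one-sided derivative at \<open>0\<close> of half the squared distance to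
  \<open>\<beta> 1\<close> along \<open>\<alpha>\<close> is at least \<open>c\<close>; the conclusion shows that this does not depend on how far the
  target is moved along \<open>\<beta>\<close>.\<close>
lemma first_variation_scaling:
  assumes \<alpha>: "geodesic M d \<alpha>" and \<beta>: "geodesic M d \<beta>" and eq: "\<alpha> 0 = \<beta> 0"
    and H: "\<And>s. 0 \<le> s \<Longrightarrow> s \<le> 1 \<Longrightarrow> (d (\<beta> 1) (\<alpha> s))\<^sup>2 \<ge> (d (\<beta> 0) (\<beta> 1))\<^sup>2 + 2 * c * s"
    and s: "0 \<le> s" "s \<le> 1" and t: "0 \<le> t" "t \<le> 1"
  shows "c * s \<le> d (\<beta> 0) (\<beta> 1) * (d (\<alpha> s) (\<beta> t) - t * d (\<beta> 0) (\<beta> 1))"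
proof -
  define B where "B = d (\<beta> 0) (\<beta> 1)"
  define f where "f = d (\<alpha> s) (\<beta> t) - t * B"
  \<comment> \<open>Convexity along \<open>\<alpha>\<close> bounds the distance at parameter
    \<open>e * s\<close> by \<open>B + e * f\<close>. Squaring, comparing with \<open>H\<close> and
    dividing by \<open>e\<close> leaves an error that vanishes with \<open>e\<close>.\<close>
  have "2 * (c * s) \<le> 2 * (B * f) + e * f\<^sup>2" if e: "0 < e" "e \<le> 1" for e
  proof -
    have es: "0 \<le> e * s" "e * s \<le> 1"
      using e s mult_mono[of e 1 s 1] by auto
    have inM: "\<beta> 1 \<in> M" "\<beta> t \<in> M" "\<alpha> (e * s) \<in> M"
      using \<alpha> \<beta> t es by (auto intro: geodesic_in)
    have "d (\<beta> 1) (\<alpha> (e * s)) \<le> d (\<beta> 1) (\<beta> t) + d (\<beta> t) (\<alpha> (e * s))"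
      using inM by (intro triangle)
    moreover have "d (\<beta> 1) (\<beta> t) = (1 - t) * B"
      using geodesic_dist[OF \<beta>, of 1 t] t by (simp add: B_def)
    moreover have "d (\<beta> t) (\<alpha> (e * s)) \<le> (1 - e) * (t * B) + e * d (\<alpha> s) (\<beta> t)"
      using dist_point_convex[OF inM(2) geodesic_sub[OF \<alpha>, of 0 s], of e] e s t
        geodesic_dist[OF \<beta>, of t 0] eq by (simp add: B_def commute)
    ultimately have "d (\<beta> 1) (\<alpha> (e * s)) \<le> B + e * f"
      by (simp add: f_def algebra_simps)
    then have "(d (\<beta> 1) (\<alpha> (e * s)))\<^sup>2 \<le> (B + e * f)\<^sup>2"
      by (intro power_mono) auto
    with H[OF es] have "B\<^sup>2 + 2 * c * (e * s) \<le> (B + e * f)\<^sup>2"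
      by (simp add: B_def)
    then have "e * (2 * (c * s)) \<le> e * (2 * (B * f) + e * f\<^sup>2)"
      by (simp add: power2_eq_square algebra_simps)
    then show ?thesis using e by simp
  qed
  then have "2 * (c * s) \<le> 2 * (B * f)"
    by (rule real_le_of_forall_eps)
  then show ?thesis by (simp add: B_def f_def)
qed

section \<open>Geodesics in the product with the real line\<close>

lemma prod2_metric_space: "Metric_space (prod2_carrier M) (prod2_dist d)"
proof -
  interpret P: Metric_space12 M d UNIV "dist :: real \<Rightarrow> real \<Rightarrow> real"
    by (intro Metric_space12.intro Metric_space_axioms Met_TC.Metric_space_axioms)
  have "prod_dist d dist = prod2_dist d"
    by (auto simp: prod_dist_def prod2_dist_def dist_real_def fun_eq_iff)
  then show ?thesis
    using P.prod_metric by (simp add: prod2_carrier_def)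
qed

lemma geodesic_prod2_components:
  assumes \<rho>: "geodesic (prod2_carrier M) (prod2_dist d) \<rho>"
  shows "geodesic M d (fst \<circ> \<rho>)"
    and "0 \<le> t \<Longrightarrow> t \<le> 1 \<Longrightarrow> snd (\<rho> t) = snd (\<rho> 0) + t * (snd (\<rho> 1) - snd (\<rho> 0))"
proof -
  have inM: "fst (\<rho> t) \<in> M" if "0 \<le> t" "t \<le> 1" for t
    using geodesic_in[OF \<rho> that] by (auto simp: prod2_carrier_def)
  \<comment> \<open>Stated for every geodesic \<open>\<sigma>\<close>, since it is also applied to
    reversed pieces of \<open>\<rho>\<close>.\<close>
  have comp: "d (fst (\<sigma> 0)) (fst (\<sigma> t)) = t * d (fst (\<sigma> 0)) (fst (\<sigma> 1))
      \<and> \<bar>snd (\<sigma> 0) - snd (\<sigma> t)\<bar> = t * \<bar>snd (\<sigma> 0) - snd (\<sigma> 1)\<bar>"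
    if \<sigma>: "geodesic (prod2_carrier M) (prod2_dist d) \<sigma>" and t: "0 \<le> t" "t \<le> 1" for \<sigma> t
  proof -
    have sqd: "(prod2_dist d p q)\<^sup>2 = (d (fst p) (fst q))\<^sup>2 + \<bar>snd p - snd q\<bar>\<^sup>2" for p q
      by (simp add: prod2_dist_def)
    have inM: "fst (\<sigma> t) \<in> M" if "0 \<le> t" "t \<le> 1" for t
      using geodesic_in[OF \<sigma> that] by (auto simp: prod2_carrier_def)
    have e1: "(d (fst (\<sigma> 0)) (fst (\<sigma> t)))\<^sup>2 + \<bar>snd (\<sigma> 0) - snd (\<sigma> t)\<bar>\<^sup>2
        = t\<^sup>2 * ((d (fst (\<sigma> 0)) (fst (\<sigma> 1)))\<^sup>2 + \<bar>snd (\<sigma> 0) - snd (\<sigma> 1)\<bar>\<^sup>2)"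
      using geodesic_dist[OF \<sigma>, of 0 t] t unfolding sqd[symmetric] by (simp add: power_mult_distrib)
    have e2: "(d (fst (\<sigma> t)) (fst (\<sigma> 1)))\<^sup>2 + \<bar>snd (\<sigma> t) - snd (\<sigma> 1)\<bar>\<^sup>2
        = (1 - t)\<^sup>2 * ((d (fst (\<sigma> 0)) (fst (\<sigma> 1)))\<^sup>2 + \<bar>snd (\<sigma> 0) - snd (\<sigma> 1)\<bar>\<^sup>2)"
      using geodesic_dist[OF \<sigma>, of t 1] t unfolding sqd[symmetric]
      by (simp add: power_mult_distrib power2_commute)
    have "d (fst (\<sigma> 0)) (fst (\<sigma> 1)) \<le> d (fst (\<sigma> 0)) (fst (\<sigma> t)) + d (fst (\<sigma> t)) (fst (\<sigma> 1))"
      using inM t by (intro triangle) auto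
    from minkowski_equality[OF _ _ this _ e1 e2 t] show ?thesis by simp
  qed
  \<comment> \<open>On the piece from \<open>t\<close> back to \<open>0\<close>, the point
    \<open>\<rho> s\<close> has parameter \<open>(t - s) / t\<close>.\<close>
  have ordered: "d (fst (\<rho> s)) (fst (\<rho> t)) = (t - s) * d (fst (\<rho> 0)) (fst (\<rho> 1))"
    if "0 \<le> s" "s \<le> t" "t \<le> 1" for s t
  proof (cases "t = 0")
    case False
    let ?D = "d (fst (\<rho> 0)) (fst (\<rho> 1))"
    have div: "(t - s) / t \<le> 1" "0 \<le> (t - s) / t" "t + (t - s) / t * (0 - t) = s"
      using that False by (auto simp: field_simps)
    have "d (fst (\<rho> t)) (fst (\<rho> s)) = (t - s) / t * d (fst (\<rho> t)) (fst (\<rho> 0))"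
      using comp[OF geodesic_sub[OF \<rho>, of t 0] div(2,1)] that div(3) by simp
    moreover have "d (fst (\<rho> t)) (fst (\<rho> 0)) = t * ?D"
      using comp[OF \<rho>, of t] that by (simp add: commute)
    ultimately show ?thesis using False by (simp add: commute)
  qed (use that inM in auto)
  have linear: "d (fst (\<rho> t)) (fst (\<rho> s)) = \<bar>t - s\<bar> * d (fst (\<rho> 0)) (fst (\<rho> 1))"
    if "s \<in> {0..1}" "t \<in> {0..1}" for s t
    using ordered[of s t] ordered[of t s] that by (cases "s \<le> t") (auto simp: commute)
  show "geodesic M d (fst \<circ> \<rho>)"
    unfolding geodesic_def o_def by (intro conjI ballI linear) (auto intro: inM)
  assume t: "0 \<le> t" "t \<le> 1"
  have "\<bar>snd (\<rho> 0) - snd (\<rho> t)\<bar> = t * \<bar>snd (\<rho> 0) - snd (\<rho> 1)\<bar>"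
    using comp[OF \<rho> t] by simp
  \<comment> \<open>\<open>comp\<close> knows only absolute values; the distances to both ends
    together fix the position on the line.\<close>
  moreover have "\<bar>snd (\<rho> 1) - snd (\<rho> t)\<bar> = (1 - t) * \<bar>snd (\<rho> 1) - snd (\<rho> 0)\<bar>"
    using comp[OF geodesic_sub[OF \<rho>, of 1 0], of "1 - t"] t by simp
  moreover have "\<bar>t * (snd (\<rho> 1) - snd (\<rho> 0))\<bar> = t * \<bar>snd (\<rho> 0) - snd (\<rho> 1)\<bar>"
    using t by (simp add: abs_mult abs_minus_commute)
  moreover have "(1 - t) * \<bar>snd (\<rho> 1) - snd (\<rho> 0)\<bar>
      = \<bar>snd (\<rho> 0) - snd (\<rho> 1)\<bar> - t * \<bar>snd (\<rho> 0) - snd (\<rho> 1)\<bar>"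
    by (simp add: left_diff_distrib abs_minus_commute)
  moreover have "0 \<le> t * (snd (\<rho> 1) - snd (\<rho> 0))" if "snd (\<rho> 0) \<le> snd (\<rho> 1)"
    using that t by simp
  moreover have "t * (snd (\<rho> 1) - snd (\<rho> 0)) \<le> 0" if "snd (\<rho> 1) \<le> snd (\<rho> 0)"
    using that t by (simp add: mult_nonneg_nonpos)
  ultimately show "snd (\<rho> t) = snd (\<rho> 0) + t * (snd (\<rho> 1) - snd (\<rho> 0))"
    by argo
qed

lemma geodesic_prod2_unique:
  assumes \<rho>: "geodesic (prod2_carrier M) (prod2_dist d) \<rho>"
    and \<sigma>: "geodesic (prod2_carrier M) (prod2_dist d) \<sigma>"
    and eq: "\<rho> 0 = \<sigma> 0" "\<rho> 1 = \<sigma> 1" and t: "0 \<le> t" "t \<le> 1"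
  shows "\<rho> t = \<sigma> t"
proof (rule prod_eqI)
  show "fst (\<rho> t) = fst (\<sigma> t)"
    using geodesic_unique[OF geodesic_prod2_components(1)[OF \<rho>] geodesic_prod2_components(1)[OF \<sigma>] _ _ t]
      eq by simp
  show "snd (\<rho> t) = snd (\<sigma> t)"
    using geodesic_prod2_components(2)[OF \<rho> t] geodesic_prod2_components(2)[OF \<sigma> t] eq by simp
qed

lemma A_of_NE:
  assumes NE: "prop_NE (prod2_carrier M) (prod2_dist d)"
  shows "prop_A (prod2_carrier M) (prod2_dist d)"
  unfolding prop_A_def
proof (intro allI impI ballI; elim conjE)
  let ?X = "prod2_carrier M" and ?\<delta> = "prod2_dist d"
  interpret P: Metric_space ?X ?\<delta> by (rule prod2_metric_space)
  fix \<gamma> x t xc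
  assume \<gamma>: "geodesic ?X ?\<delta> \<gamma>" and x: "x \<in> ?X" and t: "t \<in> {0..1::real}"
    and xc: "xc \<in> proj ?\<delta> (\<gamma> ` {0..1}) x"
  have sub: "\<gamma> ` {0..1} \<subseteq> ?X" using \<gamma> by (auto intro: geodesic_in)
  have "geod_convex ?X ?\<delta> (\<gamma> ` {0..1})"
    unfolding geod_convex_def
  proof (intro conjI sub allI impI subsetI; elim conjE)
    fix \<rho> p assume \<rho>: "geodesic ?X ?\<delta> \<rho>" and "\<rho> 0 \<in> \<gamma> ` {0..1}" "\<rho> 1 \<in> \<gamma> ` {0..1}"
      and "p \<in> \<rho> ` {0..1}"
    then obtain a b s where ab: "\<rho> 0 = \<gamma> a" "\<rho> 1 = \<gamma> b" "p = \<rho> s"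
      "0 \<le> a" "a \<le> 1" "0 \<le> b" "b \<le> 1" "0 \<le> s" "s \<le> 1" by auto
    have "\<rho> s = \<gamma> (a + s * (b - a))"
      using geodesic_prod2_unique[OF \<rho> geodesic_sub[OF \<gamma> ab(4-7)] _ _ ab(8,9)] ab by simp
    then show "p \<in> \<gamma> ` {0..1}"
      using affine_in_unit_interval[OF ab(4-9)] ab(3) by auto
  qed
  \<comment> \<open>The second point in (NE) is \<open>\<gamma> t\<close>, which is its own
    projection.\<close>
  moreover have "\<gamma> t \<in> proj ?\<delta> (\<gamma> ` {0..1}) (\<gamma> t)"
    using t sub P.nonneg P.zero unfolding proj_def by (auto simp: image_subset_iff)
  ultimately show "?\<delta> xc (\<gamma> t) \<le> ?\<delta> x (\<gamma> t)"
    using NE P.closedin_geodesic_image[OF \<gamma>] sub x xc t unfolding prop_NE_def by blast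
qed

end

section \<open>Exchanging first variations under (SO)\<close>

locale busemann_SO = busemann_space +
  assumes SO: "prop_SO (prod2_carrier M) (prod2_dist d)"
begin

lemma geodesic_prod2_affine:
  assumes "geodesic M d \<alpha>"
  shows "geodesic (prod2_carrier M) (prod2_dist d) (\<lambda>t. (\<alpha> t, a * t))"
  unfolding geodesic_def
proof (intro conjI ballI)
  fix s t :: real assume st: "s \<in> {0..1}" "t \<in> {0..1}"
  have "(d (\<alpha> t) (\<alpha> s))\<^sup>2 + (a * t - a * s)\<^sup>2 = \<bar>t - s\<bar>\<^sup>2 * ((d (\<alpha> 0) (\<alpha> 1))\<^sup>2 + a\<^sup>2)"
    using st geodesic_dist[OF assms, of t s]
    by (simp add: power_mult_distrib) (simp add: power2_eq_square algebra_simps)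
  then show "prod2_dist d (\<alpha> t, a * t) (\<alpha> s, a * s)
      = \<bar>t - s\<bar> * prod2_dist d (\<alpha> 0, a * 0) (\<alpha> 1, a * 1)"
    by (simp add: prod2_dist_def real_sqrt_mult)
qed (use assms in \<open>auto simp: prod2_carrier_def intro: geodesic_in\<close>)

text \<open>The perturbation \<open>(\<alpha> s, a s)\<close>, \<open>(\<beta> t, b t)\<close> with \<open>a b = c\<close> turns the inequality between
  first variations into orthogonality in the product; letting \<open>a\<close> tend to infinity removes the
  error term \<open>b\<^sup>2 s\<^sup>2\<close>.\<close>
lemma first_variation_symmetric:
  assumes \<alpha>: "geodesic M d \<alpha>" and \<beta>: "geodesic M d \<beta>" and eq: "\<alpha> 0 = \<beta> 0"
    and H: "\<And>s. 0 \<le> s \<Longrightarrow> s \<le> 1 \<Longrightarrow> (d (\<beta> 1) (\<alpha> s))\<^sup>2 \<ge> (d (\<beta> 0) (\<beta> 1))\<^sup>2 + 2 * c * s"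
    and s: "0 \<le> s" "s \<le> 1"
  shows "(d (\<alpha> 1) (\<beta> s))\<^sup>2 \<ge> (d (\<alpha> 0) (\<alpha> 1))\<^sup>2 + 2 * c * s"
proof -
  define A where "A = d (\<alpha> 0) (\<alpha> 1)"
  define B where "B = d (\<beta> 0) (\<beta> 1)"
  have "A\<^sup>2 + 2 * c * s \<le> (d (\<alpha> 1) (\<beta> s))\<^sup>2 + e * (c\<^sup>2 * s\<^sup>2)" if e: "0 < e" for e
  proof -
    define a where "a = 1 / sqrt e"
    define b where "b = c * sqrt e"
    have ab: "a * b = c" and b2: "b\<^sup>2 = e * c\<^sup>2"
      using e by (auto simp: a_def b_def power_mult_distrib)
    let ?\<alpha> = "\<lambda>t. (\<alpha> t, a * t)" and ?\<beta> = "\<lambda>t. (\<beta> t, b * t)"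
    have "perp (prod2_dist d) (?\<beta> 0) ?\<beta> ?\<alpha>"
      unfolding perp_def
    proof (intro ballI)
      fix s t :: real assume "s \<in> {0..1}" "t \<in> {0..1}"
      then have s: "0 \<le> s" "s \<le> 1" and t: "0 \<le> t" "t \<le> 1" by auto
      let ?e = "d (\<alpha> s) (\<beta> t)"
      have "t * (c * s) \<le> t * (B * (?e - t * B))"
        using first_variation_scaling[OF \<alpha> \<beta> eq H s t] t unfolding B_def
        by (intro mult_left_mono) auto
      \<comment> \<open>This square replaces \<open>2 * t * B * ?e\<close> by
        \<open>?e\<^sup>2 + (t * B)\<^sup>2\<close>; the term \<open>2 * (a * b) * s * t\<close> so
        obtained then cancels the cross term of \<open>(a * s - b * t)\<^sup>2\<close>.\<close>
      moreover have "(?e - t * B)\<^sup>2 \<ge> 0" by simp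
      ultimately have "(t * B)\<^sup>2 + 2 * (a * b) * s * t \<le> ?e\<^sup>2"
        unfolding ab by (simp add: power2_eq_square algebra_simps)
      then have "(t * B)\<^sup>2 + (b * t)\<^sup>2 \<le> ?e\<^sup>2 + (a * s - b * t)\<^sup>2"
        using zero_le_power2[of "a * s"] by (simp add: power2_eq_square algebra_simps)
      moreover have "d (\<beta> 0) (\<beta> t) = t * B"
        using geodesic_dist[OF \<beta>, of 0 t] t by (simp add: B_def)
      ultimately show "prod2_dist d (?\<beta> 0) (?\<beta> t) \<le> prod2_dist d (?\<alpha> s) (?\<beta> t)"
        by (simp add: prod2_dist_def)
    qed
    moreover have "?\<beta> 0 = ?\<alpha> 0" using eq by simp
    ultimately have "perp (prod2_dist d) (?\<beta> 0) ?\<alpha> ?\<beta>"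
      using SO geodesic_prod2_affine[OF \<alpha>] geodesic_prod2_affine[OF \<beta>]
      unfolding prop_SO_def by blast
    then have "prod2_dist d (?\<beta> 0) (?\<alpha> 1) \<le> prod2_dist d (?\<beta> s) (?\<alpha> 1)"
      using s unfolding perp_def by fastforce
    then have "A\<^sup>2 + a\<^sup>2 \<le> (d (\<alpha> 1) (\<beta> s))\<^sup>2 + (b * s - a)\<^sup>2"
      by (simp add: prod2_dist_def A_def eq commute)
    also have "(b * s - a)\<^sup>2 = b\<^sup>2 * s\<^sup>2 - 2 * (a * b) * s + a\<^sup>2"
      by (simp add: power2_eq_square algebra_simps)
    finally show ?thesis by (simp add: ab b2 mult.assoc)
  qed
  then show ?thesis unfolding A_def by (rule real_le_of_forall_eps)
qed

section \<open>Quadratic growth of the squared distance and the midpoint inequality\<close>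

text \<open>By convexity the secant slope over \<open>[a, b]\<close> bounds the first variation from
  \<open>\<gamma> a\<close> back to \<open>\<gamma> 0\<close>. Exchanged, it becomes a variation
  along the geodesic \<open>\<kappa>\<close> from \<open>\<gamma> a\<close> to \<open>y\<close>,
  which \<open>first_variation_scaling\<close> bounds above through
  \<open>d y (\<gamma> 0)\<close>.\<close>

lemma dist_square_increment_linear:
  assumes y: "y \<in> M" and \<gamma>: "geodesic M d \<gamma>" and a: "0 < a" "a \<le> b" "b \<le> 1"
  defines "L \<equiv> d (\<gamma> 0) (\<gamma> 1)"
  shows "(d y (\<gamma> a))\<^sup>2 + 2 * (b - a) * L * (a * L - d y (\<gamma> 0)) \<le> (d y (\<gamma> b))\<^sup>2"
proof (cases "a = b")
  case False
  define m where "m = (d y (\<gamma> b))\<^sup>2 - (d y (\<gamma> a))\<^sup>2"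
  \<comment> \<open>Minus half the secant slope over \<open>[a, b]\<close>, times \<open>a\<close>
    because \<open>?\<alpha>\<close> covers the parameter range from \<open>a\<close> to
    \<open>0\<close> in unit time.\<close>
  define c where "c = - (a * m) / (2 * (b - a))"
  have q: "\<gamma> a \<in> M" using \<gamma> a by (auto intro: geodesic_in)
  obtain \<kappa> where \<kappa>: "geodesic M d \<kappa>" "\<kappa> 0 = \<gamma> a" "\<kappa> 1 = y"
    using obtain_geodesic q y by blast
  let ?\<alpha> = "\<lambda>s. \<gamma> (a + s * (0 - a))"
  have \<alpha>: "geodesic M d ?\<alpha>" using a by (intro geodesic_sub[OF \<gamma>]) auto
  have A: "d (?\<alpha> 0) (?\<alpha> 1) = a * L"
    using geodesic_dist[OF \<gamma>, of a 0] a by (simp add: L_def)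
  have H: "(d (\<kappa> 1) (?\<alpha> s))\<^sup>2 \<ge> (d (\<kappa> 0) (\<kappa> 1))\<^sup>2 + 2 * c * s" if s: "0 \<le> s" "s \<le> 1" for s
  proof -
    have sa: "0 \<le> a + s * (0 - a)" "a + s * (0 - a) \<le> a"
      using s a mult_right_mono[of s 1 a] by auto
    have "(b - a + s * a) * (d y (\<gamma> a))\<^sup>2
        \<le> (b - a) * (d y (?\<alpha> s))\<^sup>2 + s * a * (d y (\<gamma> b))\<^sup>2"
      using dist_square_three_point[OF y \<gamma> sa a(2,3)] by (simp add: algebra_simps)
    moreover have "(b - a) * (2 * c * s) = - (s * a * m)"
    proof -
      have "2 * (b - a) \<noteq> 0" using False by simp
      then have "c * (2 * (b - a)) = - (a * m)"
        unfolding c_def by (rule nonzero_eq_divide_eq[THEN iffD1]) simp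
      moreover have "(b - a) * (2 * c * s) = c * (2 * (b - a)) * s"
        by (simp add: algebra_simps)
      ultimately show ?thesis by (simp add: mult_ac)
    qed
    ultimately have "(b - a) * ((d y (\<gamma> a))\<^sup>2 + 2 * c * s) \<le> (b - a) * (d y (?\<alpha> s))\<^sup>2"
      by (simp only: distrib_left) (simp add: m_def algebra_simps)
    then show ?thesis using False a \<kappa> by (simp add: commute)
  qed
  have sym: "(d (?\<alpha> 1) (\<kappa> s))\<^sup>2 \<ge> (d (?\<alpha> 0) (?\<alpha> 1))\<^sup>2 + 2 * c * s" if "0 \<le> s" "s \<le> 1" for s
    using first_variation_symmetric[OF \<alpha> \<kappa>(1) _ H that] \<kappa> by simp
  have "c * 1 \<le> (a * L) * (d (\<kappa> 1) (?\<alpha> 1) - 1 * (a * L))"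
    using first_variation_scaling[OF \<kappa>(1) \<alpha> _ sym, of 1 1] \<kappa> unfolding A by simp
  then have "a * (- m / (2 * (b - a))) \<le> a * (L * (d y (\<gamma> 0) - a * L))"
    using \<kappa> by (simp add: c_def mult.assoc)
  then have "- m / (2 * (b - a)) \<le> L * (d y (\<gamma> 0) - a * L)"
    using a by (simp only: mult_le_cancel_left_pos)
  then have "- m \<le> L * (d y (\<gamma> 0) - a * L) * (2 * (b - a))"
    by (rule pos_divide_le_eq[THEN iffD1, rotated]) (use False a in simp)
  then show ?thesis unfolding m_def by (simp add: algebra_simps)
qed simp

lemma dist_square_increment:
  assumes y: "y \<in> M" and \<gamma>: "geodesic M d \<gamma>" and a: "0 < a" "a \<le> b" "b \<le> 1"
  defines "L \<equiv> d (\<gamma> 0) (\<gamma> 1)"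
  shows "(d y (\<gamma> a))\<^sup>2 + 2 * (b - a) * L * (a * L - d y (\<gamma> 0)) + (b - a)\<^sup>2 * L\<^sup>2 \<le> (d y (\<gamma> b))\<^sup>2"
proof -
  \<comment> \<open>A primitive of the slope bound \<open>2 * L * (t * L - d y (\<gamma> 0))\<close>
    is subtracted; the linear estimate then says that \<open>R\<close> can drop by at most
    \<open>L\<^sup>2 * (b - a)\<^sup>2\<close>.\<close>
  define R where "R t = (d y (\<gamma> t))\<^sup>2 - L\<^sup>2 * t\<^sup>2 + 2 * t * L * d y (\<gamma> 0)" for t
  have "R a \<le> R b"
  proof (rule mono_of_quadratic_defect[OF _ a])
    fix a b :: real assume "0 < a" "a \<le> b" "b \<le> 1"
    from dist_square_increment_linear[OF y \<gamma> this]
    show "R a \<le> R b + L\<^sup>2 * (b - a)\<^sup>2"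
      unfolding R_def L_def by (simp add: power2_eq_square algebra_simps)
  qed
  then show ?thesis unfolding R_def by (simp add: power2_eq_square algebra_simps)
qed

text \<open>The increment estimate is applied to the point \<open>\<kappa> \<epsilon>\<close> on the
  geodesic from \<open>\<gamma> a\<close> to \<open>x\<close>, over an interval of length
  \<open>\<epsilon> * (1 - a)\<close>. Every term then carries the factor
  \<open>\<epsilon>\<^sup>2\<close>, which cancels.\<close>

lemma dist_square_secant:
  assumes x: "x \<in> M" and \<gamma>: "geodesic M d \<gamma>" and a: "0 < a" "a \<le> 1"
  shows "(d x (\<gamma> a))\<^sup>2 + (1 - a) * (((d x (\<gamma> a))\<^sup>2 - (d x (\<gamma> 0))\<^sup>2) / a)
      + (1 - a)\<^sup>2 * (d (\<gamma> 0) (\<gamma> 1))\<^sup>2 \<le> (d x (\<gamma> 1))\<^sup>2"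
proof -
  define L where "L = d (\<gamma> 0) (\<gamma> 1)"
  define K where "K t = (d x (\<gamma> t))\<^sup>2" for t
  have "K a + (1 - a) * ((K a - K 0) / a) + (1 - a)\<^sup>2 * L\<^sup>2 \<le> K 1 + \<theta> * (2 * (1 - a) / a)"
    if \<theta>: "0 < \<theta>" for \<theta>
  proof -
    define c where "c = (K 0 - K a) / 2 + \<theta>"
    have q: "\<gamma> a \<in> M" using \<gamma> a by (auto intro: geodesic_in)
    obtain \<kappa> where \<kappa>: "geodesic M d \<kappa>" "\<kappa> 0 = \<gamma> a" "\<kappa> 1 = x"
      using obtain_geodesic q x by blast
    let ?\<alpha> = "\<lambda>s. \<gamma> (a + s * (0 - a))"
    have \<alpha>: "geodesic M d ?\<alpha>" using a by (intro geodesic_sub[OF \<gamma>]) auto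
    have A: "d (?\<alpha> 0) (?\<alpha> 1) = a * L"
      using geodesic_dist[OF \<gamma>, of a 0] a by (simp add: L_def)
    \<comment> \<open>If no such \<open>\<epsilon>\<close> existed, \<open>c\<close> would bound the
      variation along \<open>\<kappa>\<close> from below, hence also along \<open>?\<alpha>\<close>;
      at its end this reads \<open>K 0 + 2 * \<theta> \<le> K 0\<close>.\<close>
    have "\<exists>\<epsilon>. 0 \<le> \<epsilon> \<and> \<epsilon> \<le> 1 \<and> (d (?\<alpha> 1) (\<kappa> \<epsilon>))\<^sup>2 < (d (?\<alpha> 0) (?\<alpha> 1))\<^sup>2 + 2 * c * \<epsilon>"
    proof (rule ccontr)
      assume "\<not> ?thesis"
      then have H: "(d (?\<alpha> 1) (\<kappa> s))\<^sup>2 \<ge> (d (?\<alpha> 0) (?\<alpha> 1))\<^sup>2 + 2 * c * s" if "0 \<le> s" "s \<le> 1" for s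
        using that by (meson not_less)
      from first_variation_symmetric[OF \<kappa>(1) \<alpha> _ H, of 1] \<kappa>
      have "K a + 2 * c \<le> K 0" by (simp add: K_def commute)
      then show False using \<theta> by (simp add: c_def field_simps)
    qed
    then obtain \<epsilon> where \<epsilon>: "0 \<le> \<epsilon>" "\<epsilon> \<le> 1"
      and less: "(d (\<kappa> \<epsilon>) (\<gamma> 0))\<^sup>2 < (a * L)\<^sup>2 + 2 * c * \<epsilon>"
      unfolding A by (auto simp: commute)
    have "d (\<kappa> 0) (\<gamma> 0) = a * L"
      using A \<kappa> by simp
    with less have \<epsilon>0: "0 < \<epsilon>" using \<epsilon> by (cases "\<epsilon> = 0") auto
    \<comment> \<open>\<open>\<gamma> b\<close> has parameter \<open>\<epsilon>\<close> on the
      geodesic from \<open>\<gamma> a\<close> to \<open>\<gamma> 1\<close>, so Busemann convexity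
      compares it with \<open>\<kappa> \<epsilon>\<close>.\<close>
    define b where "b = a + \<epsilon> * (1 - a)"
    have b: "a \<le> b" "b \<le> 1"
      using affine_in_unit_interval[of a 1 \<epsilon>] \<epsilon> a by (auto simp: b_def)
    let ?D = "d (\<kappa> \<epsilon>) (\<gamma> 0)"
    have "- (c * \<epsilon>) \<le> a * (L * (a * L - ?D))"
      using less zero_le_power2[of "?D - a * L"] by (simp add: power2_eq_square algebra_simps)
    then have LD: "- (c * \<epsilon> / a) \<le> L * (a * L - ?D)"
      using a by (simp add: field_simps)
    have ka: "d (\<kappa> \<epsilon>) (\<gamma> a) = \<epsilon> * d x (\<gamma> a)"
      using geodesic_dist[OF \<kappa>(1), of \<epsilon> 0] \<kappa> \<epsilon> by (simp add: commute)
    have fracs: "c * \<epsilon> / a = \<epsilon> * (c / a)" "2 * (1 - a) * c / a = 2 * (1 - a) * (c / a)"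
      by simp_all
    have "\<epsilon>\<^sup>2 * (K a + (1 - a)\<^sup>2 * L\<^sup>2 - 2 * (1 - a) * c / a)
        = (d (\<kappa> \<epsilon>) (\<gamma> a))\<^sup>2 + 2 * (b - a) * (- (c * \<epsilon> / a)) + (b - a)\<^sup>2 * L\<^sup>2"
      unfolding fracs ka b_def K_def
      by (simp only: power_mult_distrib) (simp add: power2_eq_square algebra_simps del: times_divide_eq_right)
    also have "\<dots> \<le> (d (\<kappa> \<epsilon>) (\<gamma> a))\<^sup>2 + 2 * (b - a) * (L * (a * L - ?D)) + (b - a)\<^sup>2 * L\<^sup>2"
      using LD b by (intro add_mono mult_left_mono) auto
    also have "\<dots> \<le> (d (\<kappa> \<epsilon>) (\<gamma> b))\<^sup>2"
      using dist_square_increment[OF _ \<gamma> a(1) b, of "\<kappa> \<epsilon>"] \<kappa> \<epsilon>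
      by (auto simp: L_def mult.assoc intro: geodesic_in)
    also have "d (\<kappa> \<epsilon>) (\<gamma> b) \<le> \<epsilon> * d x (\<gamma> 1)"
      using dist_geodesics_le[OF \<kappa>(1) geodesic_sub[OF \<gamma>, of a 1] _ \<epsilon>] a \<kappa> by (simp add: b_def)
    then have "(d (\<kappa> \<epsilon>) (\<gamma> b))\<^sup>2 \<le> (\<epsilon> * d x (\<gamma> 1))\<^sup>2"
      by (intro power_mono) auto
    finally have "\<epsilon>\<^sup>2 * (K a + (1 - a)\<^sup>2 * L\<^sup>2 - 2 * (1 - a) * c / a) \<le> \<epsilon>\<^sup>2 * K 1"
      by (simp add: K_def power_mult_distrib)
    then have "K a + (1 - a)\<^sup>2 * L\<^sup>2 - 2 * (1 - a) * c / a \<le> K 1"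
      using \<epsilon>0 by simp
    moreover have "2 * (1 - a) * c / a = \<theta> * (2 * (1 - a) / a) - (1 - a) * ((K a - K 0) / a)"
      using a by (simp add: c_def field_simps)
    ultimately show ?thesis by simp
  qed
  then show ?thesis unfolding K_def L_def by (rule real_le_of_forall_eps)
qed

text \<open>The secant over the short interval \<open>[1/2, u]\<close> is continued forwards to
  \<open>\<gamma> 1\<close> and backwards to \<open>\<gamma> 0\<close>. Its slope enters the two
  estimates with opposite signs and cancels in the sum; then \<open>u\<close> tends to
  \<open>1/2\<close>.\<close>

lemma dist_square_midpoint:
  assumes x: "x \<in> M" and \<gamma>: "geodesic M d \<gamma>"
  shows "(d x (\<gamma> (1/2)))\<^sup>2
    \<le> (d x (\<gamma> 0))\<^sup>2 / 2 + (d x (\<gamma> 1))\<^sup>2 / 2 - (d (\<gamma> 0) (\<gamma> 1))\<^sup>2 / 4"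
proof -
  define L where "L = d (\<gamma> 0) (\<gamma> 1)"
  define K where "K t = (d x (\<gamma> t))\<^sup>2" for t
  have "2 * K (1/2) + L\<^sup>2 / 2 \<le> K 0 + K 1 + \<theta> * (L\<^sup>2 / 2)" if \<theta>: "0 < \<theta>" "\<theta> \<le> 1" for \<theta>
  proof -
    define u where "u = (1 + \<theta>) / 2"
    define q where "q = (K u - K (1/2)) / (\<theta> / 2)"
    have u: "1/2 < u" "u \<le> 1" using \<theta> by (auto simp: u_def)
    have len: "d (\<gamma> (1/2)) (\<gamma> 1) = L / 2" "d (\<gamma> u) (\<gamma> 0) = u * L"
      using geodesic_dist[OF \<gamma>, of "1/2" 1] geodesic_dist[OF \<gamma>, of u 0] u by (auto simp: L_def)
    have "1/2 + \<theta> * (1 - 1/2) = u" by (simp add: u_def field_simps)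
    then have secant: "K u + (1 - \<theta>) * ((K u - K (1/2)) / \<theta>) + (1 - \<theta>)\<^sup>2 * (L / 2)\<^sup>2 \<le> K 1"
      using dist_square_secant[OF x geodesic_sub[OF \<gamma>, of "1/2" 1] \<theta>] by (simp add: K_def len)
    have Ku: "K u = K (1/2) + \<theta> * (q / 2)" and quot: "(K u - K (1/2)) / \<theta> = q / 2"
      using \<theta> by (auto simp: q_def field_simps)
    have 1: "K (1/2) + q / 2 + (1 - \<theta>)\<^sup>2 * (L / 2)\<^sup>2 \<le> K 1"
      using secant unfolding quot unfolding Ku by (simp add: left_diff_distrib diff_divide_distrib)
    \<comment> \<open>The parameter of \<open>\<gamma> (1/2)\<close> on the geodesic from
      \<open>\<gamma> u\<close> to \<open>\<gamma> 0\<close>.\<close>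
    define a where "a = (u - 1/2) / u"
    have a: "0 < a" "a \<le> 1" and au: "u + a * (0 - u) = 1/2" "(1 - a) * u = 1/2"
      using u by (auto simp: a_def field_simps)
    have "K (1/2) + (1 - a) * ((K (1/2) - K u) / a) + (1 - a)\<^sup>2 * (u * L)\<^sup>2 \<le> K 0"
      using dist_square_secant[OF x geodesic_sub[OF \<gamma>, of u 0] a, unfolded au(1)] u
      by (simp add: K_def len)
    moreover have "(1 - a) * ((K (1/2) - K u) / a) = - q / 2"
    proof -
      have "a = (\<theta> / 2) / u" "1 - a = (1 / 2) / u"
        using u by (auto simp: a_def u_def field_simps)
      then have "(1 - a) / a = 1 / \<theta>" using u by simp
      moreover have "(1 - a) * ((K (1/2) - K u) / a) = - ((1 - a) / a * (K u - K (1/2)))"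
        by (simp add: minus_divide_left flip: mult_minus_right)
      ultimately show ?thesis using quot by simp
    qed
    moreover have "(1 - a)\<^sup>2 * (u * L)\<^sup>2 = L\<^sup>2 / 4"
    proof -
      have "(1 - a)\<^sup>2 * (u * L)\<^sup>2 = ((1 - a) * u)\<^sup>2 * L\<^sup>2"
        by (simp add: power_mult_distrib)
      then show ?thesis unfolding au(2) by (simp add: power_divide)
    qed
    ultimately have "K (1/2) - q / 2 + L\<^sup>2 / 4 \<le> K 0"
      by simp
    with 1 have "2 * K (1/2) + L\<^sup>2 / 4 + (1 - \<theta>)\<^sup>2 * (L / 2)\<^sup>2 \<le> K 0 + K 1"
      by argo
    moreover have "(1 - 2 * \<theta>) * (L / 2)\<^sup>2 \<le> (1 - \<theta>)\<^sup>2 * (L / 2)\<^sup>2"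
      by (intro mult_right_mono) (auto simp: power2_eq_square algebra_simps)
    moreover have "(1 - 2 * \<theta>) * (L / 2)\<^sup>2 = L\<^sup>2 / 4 - \<theta> * (L\<^sup>2 / 2)"
      by (simp add: field_simps)
    ultimately show ?thesis by linarith
  qed
  then have "2 * K (1/2) + L\<^sup>2 / 2 \<le> K 0 + K 1" by (rule real_le_of_forall_eps)
  then show ?thesis by (simp add: K_def L_def)
qed

lemma CAT0: "CAT0 M d"
  unfolding CAT0_def
proof (intro ballI allI impI; elim conjE)
  fix x y z \<gamma> and x' y' z' :: "real^2"
  assume "x \<in> M" "geodesic M d \<gamma>" "\<gamma> 0 = y" "\<gamma> 1 = z"
    and "dist x' y' = d x y" "dist x' z' = d x z" "dist y' z' = d y z"
  then have "(d x (\<gamma> (1/2)))\<^sup>2 \<le> (dist x' (midpoint y' z'))\<^sup>2"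
    unfolding comparison_midpoint using dist_square_midpoint[of x \<gamma>] by simp
  then show "d x (\<gamma> (1/2)) \<le> dist x' (midpoint y' z')"
    by (rule power2_le_imp_le) simp
qed

end

theorem theorem2:
  fixes M :: "'a set" and d :: "'a \<Rightarrow> 'a \<Rightarrow> real"
  assumes "Metric_space M d"
    and "Metric_space.mcomplete M d"
    and "geodesic_space M d"
    and "busemann_convex M d"
    and "\<And>(lam::nat \<Rightarrow> real) \<omega> x. (\<forall>n. lam n > 0) \<Longrightarrow> lam \<longlonglongrightarrow> 0 \<Longrightarrow>
           nonprincipal_ultrafilter \<omega> \<Longrightarrow> x \<in> M \<Longrightarrow>
           geodesic_space (tan_space M d lam \<omega> x) (tan_dist d lam \<omega>) \<and>
           busemann_convex (tan_space M d lam \<omega> x) (tan_dist d lam \<omega>)"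
    and "prop_SO (prod2_carrier M) (prod2_dist d) \<or>
         prop_A (prod2_carrier M) (prod2_dist d) \<or>
         prop_NE (prod2_carrier M) (prod2_dist d)"
  shows "CAT0 M d"
proof -
  interpret busemann_space M d
    using assms(1,3,4) by (simp add: busemann_space_def busemann_space_axioms_def)
  have com: "prod2_dist d p q = prod2_dist d q p" for p q
    by (simp add: prod2_dist_def commute power2_commute)
  have "prop_SO (prod2_carrier M) (prod2_dist d)"
    using assms(6) A_of_NE SO_of_A[of "prod2_dist d", OF com] by blast
  then interpret busemann_SO M d
    by unfold_locales
  show ?thesis by (rule CAT0)
qed

end
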